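(* Let $m,n\ge 1$, let $A_1,\dots,A_m\in S^n$, and let $$r^*=\max\left\{\mathrm{rank}\Big(\sum_{i=1}^m t_iA_i\Big):\ \sum_{i=1}^m t_iA_i\succeq 0,\ t_i\in R,\ i=1,\dots,m\right\}.$$ Let $\eta^*$ be the optimal value of the semidefinite programming problem $$\max\left\{\sum_{i=1}^m t_i\,\mathrm{tr}(A_i):\ \sum_{i=1}^m t_iA_i\succeq 0,\ \sum_{i=1}^m t_iA_i\preceq I,\ t_i\in R\right\}$$ or of its dual problem $$\min\{\langle I,X\rangle:\ \langle A_i,X\rangle-\langle A_i,Y\rangle=\mathrm{tr}(A_i),\ i=1,\dots,m,\ X\succeq 0,\ Y\succeq 0\}$$ (the two optimal values coincide). When $r^*\le n-2$, every nonzero solution $X$ of the system $$\langle A_i,X\rangle=0,\quad i=1,\dots,m,\qquad X\succeq 0,\qquad X\in S^n,$$ satisfies $\mathrm{rank}(X)\le n-\lceil\eta^*\rceil$.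
   Context: $S^n$ is the set of real symmetric $n\times n$ matrices; $\langle X,Y\rangle=\mathrm{tr}(X^TY)$; $X\succeq 0$ means positive semidefinite and $X\preceq I$ means $I-X\succeq 0$; $I$ is the identity matrix; $\lceil\cdot\rceil$ is the ceiling function. *)

theory Defs
  imports "HOL-Analysis.Analysis"
begin

text \<open>
  \<open>S\<^sup>n\<close> is rendered by the symmetric matrices of type \<open>real^'n^'n\<close>, with \<open>n = CARD('n)\<close>.
  Families \<open>A\<^sub>1, \<dots>, A\<^sub>m\<close> and \<open>t\<^sub>1, \<dots>, t\<^sub>m\<close> are functions on \<open>nat\<close> of which only the
  values at \<open>{1..m}\<close> are ever used.
\<close>

definition symmetric_mat :: "real^'n^'n \<Rightarrow> bool" where
  "symmetric_mat X \<longleftrightarrow> transpose X = X"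

definition psd :: "real^'n^'n \<Rightarrow> bool" where
  "psd X \<longleftrightarrow> symmetric_mat X \<and> (\<forall>v. 0 \<le> v \<bullet> (X *v v))"

definition loewner_le :: "real^'n^'n \<Rightarrow> real^'n^'n \<Rightarrow> bool" where
  "loewner_le X Y \<longleftrightarrow> psd (Y - X)"

definition mat_inner :: "real^'n^'n \<Rightarrow> real^'n^'n \<Rightarrow> real" where
  "mat_inner X Y = trace (transpose X ** Y)"

definition lin_comb :: "nat \<Rightarrow> (nat \<Rightarrow> real^'n^'n) \<Rightarrow> (nat \<Rightarrow> real) \<Rightarrow> real^'n^'n" where
  "lin_comb m A t = (\<Sum>i=1..m. t i *\<^sub>R A i)"

definition max_psd_rank :: "nat \<Rightarrow> (nat \<Rightarrow> real^'n^'n) \<Rightarrow> nat" where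
  "max_psd_rank m A = Max {rank (lin_comb m A t) | t. psd (lin_comb m A t)}"

definition primal_values :: "nat \<Rightarrow> (nat \<Rightarrow> real^'n^'n) \<Rightarrow> real set" where
  "primal_values m A =
     {(\<Sum>i=1..m. t i * trace (A i)) | t.
        psd (lin_comb m A t) \<and> loewner_le (lin_comb m A t) (mat 1)}"

definition dual_values :: "nat \<Rightarrow> (nat \<Rightarrow> real^'n^'n) \<Rightarrow> real set" where
  "dual_values m A =
     {mat_inner (mat 1) X | X Y.
        (\<forall>i\<in>{1..m}. mat_inner (A i) X - mat_inner (A i) Y = trace (A i)) \<and> psd X \<and> psd Y}"

text \<open>
  The optimal value of a maximization (minimization) problem is the supremum (infimum) of the
  objective over the feasible set. The primal supremum is a maximum, because the feasible matrices
  form a compact set. The dual infimum need not be attained, so it must not be read as an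
  attained minimum.
  Both value sets are nonempty and bounded on the relevant side, as shown below, so the real-valued
  \<open>Sup\<close> and \<open>Inf\<close> are the genuine ones.
\<close>

definition primal_opt :: "nat \<Rightarrow> (nat \<Rightarrow> real^'n^'n) \<Rightarrow> real" where
  "primal_opt m A = Sup (primal_values m A)"

definition dual_opt :: "nat \<Rightarrow> (nat \<Rightarrow> real^'n^'n) \<Rightarrow> real" where
  "dual_opt m A = Inf (dual_values m A)"

lemma psd_0: "psd 0"
  by (simp add: psd_def symmetric_mat_def transpose_def vec_eq_iff)

lemma psd_mat_nonneg: "0 \<le> c \<Longrightarrow> psd (mat c :: real^'n^'n)"
proof -
  assume "0 \<le> c"
  moreover have "(mat c :: real^'n^'n) *v v = c *\<^sub>R v" for v
    by (simp add: matrix_vector_mult_def mat_def vec_eq_iff if_distrib if_distribR cong: if_cong)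
  ultimately show ?thesis
    by (simp add: psd_def symmetric_mat_def)
qed

lemma psd_trace_nonneg:
  assumes "psd X"
  shows "0 \<le> trace X"
proof -
  have "0 \<le> X $ i $ i" for i
  proof -
    have "0 \<le> axis i 1 \<bullet> (X *v axis i 1)"
      using assms by (simp add: psd_def)
    also have "\<dots> = X $ i $ i"
      by (simp add: inner_axis' matrix_vector_mul_component inner_axis)
    finally show ?thesis .
  qed
  then show ?thesis
    by (simp add: trace_def sum_nonneg)
qed

lemma trace_lin_comb: "trace (lin_comb m A t) = (\<Sum>i=1..m. t i * trace (A i))"
proof -
  have "trace (lin_comb m A t) = (\<Sum>j\<in>UNIV. \<Sum>i=1..m. t i * A i $ j $ j)"
    by (simp add: trace_def lin_comb_def)
  also have "\<dots> = (\<Sum>i=1..m. \<Sum>j\<in>UNIV. t i * A i $ j $ j)"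
    by (rule sum.swap)
  finally show ?thesis
    by (simp add: trace_def sum_distrib_left)
qed

lemma finite_psd_ranks:
  fixes A :: "nat \<Rightarrow> real^'n^'n"
  shows "finite {rank (lin_comb m A t) | t. psd (lin_comb m A t)}"
proof (rule finite_subset)
  show "{rank (lin_comb m A t) | t. psd (lin_comb m A t)} \<subseteq> {..CARD('n)}"
    using rank_bound by fastforce
qed simp

lemma psd_ranks_nonempty: "{rank (lin_comb m A t) | t. psd (lin_comb m A t)} \<noteq> {}"
proof -
  have "psd (lin_comb m A (\<lambda>_. 0))"
    by (simp add: lin_comb_def psd_0)
  then show ?thesis by blast
qed

lemma primal_values_nonempty: "primal_values m A \<noteq> {}"
proof -
  have "lin_comb m A (\<lambda>_. 0) = 0"
    by (simp add: lin_comb_def)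
  then have "psd (lin_comb m A (\<lambda>_. 0)) \<and> loewner_le (lin_comb m A (\<lambda>_. 0)) (mat 1)"
    by (simp add: loewner_le_def psd_0 psd_mat_nonneg)
  then show ?thesis
    unfolding primal_values_def by blast
qed

lemma primal_values_bdd_above: "bdd_above (primal_values m (A :: nat \<Rightarrow> real^'n^'n))"
proof (rule bdd_aboveI)
  fix v assume "v \<in> primal_values m A"
  then obtain t where "v = trace (lin_comb m A t)" "psd (mat 1 - lin_comb m A t)"
    unfolding primal_values_def loewner_le_def by (auto simp: trace_lin_comb)
  then show "v \<le> real CARD('n)"
    using psd_trace_nonneg[of "mat 1 - lin_comb m A t"] by (simp add: trace_sub trace_I)
qed

lemma dual_values_nonempty:
  assumes "\<And>i. i \<in> {1..m} \<Longrightarrow> symmetric_mat (A i)"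
  shows "dual_values m A \<noteq> {}"
proof -
  have "\<forall>i\<in>{1..m}. mat_inner (A i) (mat 1) - mat_inner (A i) 0 = trace (A i)"
    using assms by (simp add: mat_inner_def symmetric_mat_def trace_def)
  then show ?thesis
    unfolding dual_values_def using psd_0 psd_mat_nonneg[of 1] zero_le_one by blast
qed

lemma dual_values_bdd_below: "bdd_below (dual_values m A)"
  by (rule bdd_belowI[of _ 0])
    (auto simp: dual_values_def mat_inner_def psd_trace_nonneg)

end

theory Submission
  imports Defs
begin

text \<open>
  If \<open>T\<close> is primal feasible and \<open>X\<close> solves the system, then \<open>tr (T X) = 0\<close> forces \<open>T X = 0\<close>, because both
  are positive semidefinite. Hence \<open>T\<close> vanishes on the range of \<open>X\<close>, and since \<open>T\<close> is at most the
  identity, its trace is at most the dimension \<open>n - rank X\<close> of the orthogonal complement.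

  For strong duality, the point \<open>(I, inf dual)\<close> lies outside the convex cone of pairs \<open>(Z, r)\<close> for
  which some positive semidefinite \<open>X\<close>, \<open>Y\<close> satisfy \<open>tr X < r\<close> and \<open>Z - X + Y\<close> is orthogonal to all
  \<open>A\<^sub>i\<close>. The normal of a separating hyperplane, rescaled, is a primal feasible matrix whose trace
  is at least the dual value.
\<close>

section \<open>Rank-one matrices and the trace inner product\<close>

definition outer :: "real^'n \<Rightarrow> real^'n^'n" where
  "outer u = (\<chi> i j. u $ i * u $ j)"

lemma outer_nth [simp]: "outer u $ i $ j = u $ i * u $ j"
  by (simp add: outer_def)

lemma outer_mult_vec: "outer u *v v = (u \<bullet> v) *\<^sub>R u"
  by (simp add: vec_eq_iff matrix_vector_mult_def inner_vec_def sum_distrib_right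
      sum_distrib_left mult_ac)

lemma sum_outer_mult_vec: "(\<Sum>k\<in>S. outer (u k)) *v v = (\<Sum>k\<in>S. (u k \<bullet> v) *\<^sub>R u k)"
  by (induction S rule: infinite_finite_induct)
    (simp_all add: matrix_vector_mult_add_rdistrib outer_mult_vec)

lemma inner_outer: "M \<bullet> outer u = u \<bullet> (M *v u)"
  by (simp add: inner_vec_def matrix_vector_mult_def sum_distrib_left mult_ac)

lemma psd_outer: "psd (outer u)"
  by (auto simp: psd_def symmetric_mat_def outer_mult_vec vec_eq_iff transpose_def inner_commute)

text \<open>This makes the Euclidean results on separation and orthogonal complements available for
  matrices.\<close>

lemma mat_inner_eq_inner: "mat_inner X Y = X \<bullet> Y"
proof -
  have "mat_inner X Y = (\<Sum>i\<in>UNIV. \<Sum>k\<in>UNIV. X $ k $ i * Y $ k $ i)"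
    by (simp add: mat_inner_def trace_def matrix_matrix_mult_def transpose_def)
  also have "\<dots> = X \<bullet> Y"
    by (subst sum.swap) (simp add: inner_vec_def)
  finally show ?thesis .
qed

lemma trace_eq_inner: "trace X = mat 1 \<bullet> X"
  by (simp add: mat_inner_eq_inner [symmetric] mat_inner_def)

lemma symmetric_inner_swap:
  "symmetric_mat X \<Longrightarrow> v \<bullet> (X *v w) = w \<bullet> (X *v v)"
  by (metis dot_lmul_matrix inner_commute symmetric_mat_def transpose_matrix_vector)

lemma symmetric_lin_comb:
  assumes "\<And>i. i \<in> {1..m} \<Longrightarrow> symmetric_mat (A i)"
  shows "symmetric_mat (lin_comb m A t)"
proof -
  have "A i $ j $ k = A i $ k $ j" if "i \<in> {1..m}" for i j k
    using assms [OF that] by (simp add: symmetric_mat_def vec_eq_iff transpose_def)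
  then show ?thesis
    by (simp add: symmetric_mat_def vec_eq_iff transpose_def lin_comb_def)
qed

section \<open>Positive semidefinite matrices\<close>

lemma psd_scaleR: "psd X \<Longrightarrow> 0 \<le> c \<Longrightarrow> psd (c *\<^sub>R X)"
  by (auto simp: psd_def symmetric_mat_def vec_eq_iff transpose_def scaleR_matrix_vector_assoc [symmetric])

lemma psd_add: "psd X \<Longrightarrow> psd Y \<Longrightarrow> psd (X + Y)"
  by (auto simp: psd_def symmetric_mat_def vec_eq_iff transpose_def
      matrix_vector_mult_add_rdistrib inner_add_right)

text \<open>The form at \<open>v + s *\<^sub>R w\<close> is a quadratic polynomial in
  \<open>s\<close> that never becomes negative.\<close>

lemma psd_Cauchy_Schwarz:
  assumes "psd X"
  shows "(v \<bullet> (X *v w))\<^sup>2 \<le> (v \<bullet> (X *v v)) * (w \<bullet> (X *v w))"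
proof -
  define a b c where "a = v \<bullet> (X *v v)" and "b = v \<bullet> (X *v w)" and "c = w \<bullet> (X *v w)"
  have b': "w \<bullet> (X *v v) = b"
    using assms by (simp add: b_def psd_def symmetric_inner_swap)
  have quad: "0 \<le> a + 2 * s * b + s\<^sup>2 * c" for s
  proof -
    have "0 \<le> (v + s *\<^sub>R w) \<bullet> (X *v (v + s *\<^sub>R w))"
      using assms by (simp add: psd_def)
    also have "\<dots> = a + 2 * s * b + s\<^sup>2 * c"
      using b'
      by (simp add: matrix_vector_right_distrib matrix_vector_mult_scaleR inner_add_left
          inner_add_right a_def b_def c_def power2_eq_square algebra_simps)
    finally show ?thesis .
  qed
  have "0 \<le> c"
    using assms by (simp add: c_def psd_def)
  have "b\<^sup>2 \<le> a * c"
  proof (cases "c = 0")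
    case True
    \<comment> \<open>With \<open>c = 0\<close> the polynomial is affine; for
      \<open>b \<noteq> 0\<close> the chosen \<open>s\<close> would give it the value -1.\<close>
    then have "b = 0"
      using quad [of "- (a + 1) / (2 * b)"] by (cases "b = 0") (auto simp: field_simps)
    then show ?thesis
      using True by simp
  next
    case False
    \<comment> \<open>The chosen \<open>s\<close> is the minimizer, where the polynomial equals
      \<open>a - b\<^sup>2 / c\<close>.\<close>
    then show ?thesis
      using quad [of "- b / c"] \<open>0 \<le> c\<close>
      by (simp add: field_simps power2_eq_square)
  qed
  then show ?thesis
    by (simp add: a_def b_def c_def)
qed

text \<open>Cauchy-Schwarz with \<open>X *v v\<close> in the first argument bounds the fourth power
  of its norm by a multiple of \<open>v \<bullet> (X *v v)\<close>.\<close>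

lemma psd_quadratic_zero:
  assumes "psd X" and "v \<bullet> (X *v v) = 0"
  shows "X *v v = 0"
  using psd_Cauchy_Schwarz [OF assms(1), of "X *v v" v] assms(2) by simp

text \<open>
  Each step splits off \<open>outer w\<close> with \<open>w\<close> the \<open>k\<close>-th column divided by the square root of its diagonal
  entry (a Schur complement). If that entry is \<open>0\<close>, the column vanishes and division by zero gives
  \<open>w = 0\<close>.
\<close>

lemma psd_decompose_on:
  fixes X :: "real^'n^'n"
  assumes "finite S" and "psd X" and "\<And>i j. i \<notin> S \<Longrightarrow> X $ i $ j = 0"
  shows "\<exists>u. X = (\<Sum>k\<in>S. outer (u k))"
  using assms
proof (induction S arbitrary: X rule: finite_induct)
  case empty
  then show ?case
    by (simp add: vec_eq_iff)
next
  case (insert k S)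
  define c where "c = X $ k $ k"
  define w where "w = (1 / sqrt c) *\<^sub>R (X *v axis k 1)"
  have col: "(X *v axis k 1) $ i = X $ i $ k" for i
    by (simp add: matrix_vector_mult_basis column_def)
  have c_eq: "c = axis k 1 \<bullet> (X *v axis k 1)"
    by (simp add: c_def inner_axis' col)
  then have "0 \<le> c"
    using insert.prems(1) by (simp add: psd_def)
  have sym: "X $ i $ j = X $ j $ i" for i j
    using insert.prems(1) by (simp add: psd_def symmetric_mat_def vec_eq_iff transpose_def)
  have w_nth: "w $ i = X $ i $ k / sqrt c" for i
    by (simp add: w_def col)
  have col0: "X $ i $ k = 0" if "c = 0" for i
    using psd_quadratic_zero [OF insert.prems(1), of "axis k 1"] c_eq that
    by (metis col zero_index)
  have "psd (X - outer w)"
    unfolding psd_def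
  proof (intro conjI allI)
    show "symmetric_mat (X - outer w)"
      using sym by (simp add: symmetric_mat_def vec_eq_iff transpose_def)
    fix v
    \<comment> \<open>Cauchy-Schwarz for \<open>X\<close> at \<open>v\<close> and
      \<open>axis k 1\<close> amounts to nonnegativity of the Schur complement at
      \<open>v\<close>.\<close>
    have "v \<bullet> w = (v \<bullet> (X *v axis k 1)) / sqrt c"
      by (simp add: w_def)
    then have "(v \<bullet> w)\<^sup>2 = (v \<bullet> (X *v axis k 1))\<^sup>2 / c"
      using \<open>0 \<le> c\<close> by (simp add: power_divide)
    also have "\<dots> \<le> v \<bullet> (X *v v)"
      using psd_Cauchy_Schwarz [OF insert.prems(1), of v "axis k 1"] \<open>0 \<le> c\<close> insert.prems(1)
      by (cases "c = 0") (auto simp: c_eq [symmetric] psd_def field_simps)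
    finally show "0 \<le> v \<bullet> ((X - outer w) *v v)"
      by (simp add: matrix_vector_mult_diff_rdistrib inner_diff_right outer_mult_vec
          power2_eq_square inner_commute)
  qed
  \<comment> \<open>Row \<open>k\<close> is cancelled by \<open>outer w\<close>. A row that is zero
    in \<open>X\<close> has a zero entry in \<open>w\<close> as well, so it stays zero.\<close>
  moreover have "(X - outer w) $ i $ j = 0" if "i \<notin> S" for i j
  proof (cases "i = k")
    case True
    show ?thesis
    proof (cases "c = 0")
      case True
      then show ?thesis
        using col0 [of j] sym [of k j] \<open>i = k\<close> by (simp add: w_nth)
    next
      case False
      then show ?thesis
        using \<open>i = k\<close> sym [of k j] \<open>0 \<le> c\<close>
        by (simp add: w_nth c_def [symmetric])
    qed
  next
    case False
    then have "X $ i $ l = 0" for l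
      using insert.prems(2) that by simp
    then show ?thesis
      by (simp add: w_nth)
  qed
  ultimately obtain u where u: "X - outer w = (\<Sum>l\<in>S. outer (u l))"
    using insert.IH by blast
  have "(\<Sum>l\<in>insert k S. outer ((u(k := w)) l)) = outer w + (\<Sum>l\<in>S. outer ((u(k := w)) l))"
    using insert.hyps by simp
  also have "(\<Sum>l\<in>S. outer ((u(k := w)) l)) = (\<Sum>l\<in>S. outer (u l))"
    using insert.hyps by (intro sum.cong) auto
  also have "outer w + \<dots> = X"
    using u by (simp add: algebra_simps)
  finally show ?case
    by metis
qed

lemma psd_decompose:
  fixes X :: "real^'n^'n"
  assumes "psd X"
  shows "\<exists>u :: 'n \<Rightarrow> real^'n. X = (\<Sum>k\<in>UNIV. outer (u k))"
  using psd_decompose_on [of UNIV X] assms by simp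

text \<open>Splitting \<open>X\<close> into rank-one terms turns the inner product into a sum of
  values of the quadratic form of \<open>T\<close>.\<close>

lemma psd_inner_nonneg:
  fixes T X :: "real^'n^'n"
  assumes "psd T" and "psd X"
  shows "0 \<le> T \<bullet> X"
proof -
  obtain u :: "'n \<Rightarrow> real^'n" where "X = (\<Sum>k\<in>UNIV. outer (u k))"
    using psd_decompose [OF assms(2)] by blast
  then show ?thesis
    using assms(1) by (auto simp: inner_sum_right inner_outer psd_def intro: sum_nonneg)
qed

text \<open>A vanishing sum of nonnegative terms forces \<open>T\<close> to kill every
  \<open>u k\<close>, and these vectors span a space containing the range of
  \<open>X\<close>.\<close>

lemma psd_inner_zero:
  fixes T X :: "real^'n^'n"
  assumes "psd T" and "psd X" and "T \<bullet> X = 0"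
  shows "T *v (X *v v) = 0"
proof -
  obtain u :: "'n \<Rightarrow> real^'n" where X: "X = (\<Sum>k\<in>UNIV. outer (u k))"
    using psd_decompose [OF assms(2)] by blast
  then have "(\<Sum>k\<in>UNIV. u k \<bullet> (T *v u k)) = 0"
    using assms(3) by (simp add: inner_sum_right inner_outer)
  then have "u k \<bullet> (T *v u k) = 0" for k
    using assms(1) by (subst (asm) sum_nonneg_eq_0_iff) (auto simp: psd_def)
  then have Tu: "T *v u k = 0" for k
    using psd_quadratic_zero [OF assms(1)] by simp
  have "X *v v = (\<Sum>k\<in>UNIV. (u k \<bullet> v) *\<^sub>R u k)"
    by (simp add: X sum_outer_mult_vec)
  then show ?thesis
    using Tu by (simp add: linear_sum [OF matrix_vector_mul_linear] matrix_vector_mult_scaleR)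
qed

section \<open>Bounding the trace by the codimension of the kernel\<close>

lemma trace_le_of_kernel:
  fixes T :: "real^'n^'n"
  assumes sym: "symmetric_mat T" and le: "loewner_le T (mat 1)"
    and S: "subspace S" and ker: "\<And>v. v \<in> S \<Longrightarrow> T *v v = 0"
  shows "trace T \<le> real CARD('n) - real (dim S)"
proof -
  obtain B where B: "pairwise orthogonal B" "\<And>b. b \<in> B \<Longrightarrow> norm b = 1"
    and card: "card B = dim (S\<^sup>\<bottom>)" and span: "span B = S\<^sup>\<bottom>"
    using orthonormal_basis_subspace [OF subspace_orthogonal_comp [of S]] by metis
  have fin: "finite B"
    using B(1) by (rule pairwise_orthogonal_imp_finite)
  \<comment> \<open>\<open>P\<close> is the orthogonal projection onto the complement of
    \<open>S\<close>, since \<open>B\<close> is an orthonormal basis of it.\<close>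
  define P where "P = (\<Sum>b\<in>B. outer b)"
  have P_mult: "P *v v = (\<Sum>b\<in>B. (b \<bullet> v) *\<^sub>R b)" for v
    by (simp add: P_def sum_outer_mult_vec)
  have orth_B: "(v - P *v v) \<bullet> b = 0" if "b \<in> B" for v b
  proof -
    have "(P *v v) \<bullet> b = (\<Sum>a\<in>B. if a = b then v \<bullet> b else 0)"
      unfolding P_mult inner_sum_left
    proof (rule sum.cong)
      fix a assume "a \<in> B"
      then show "((a \<bullet> v) *\<^sub>R a) \<bullet> b = (if a = b then v \<bullet> b else 0)"
        using B that
        by (auto simp: pairwise_def orthogonal_def inner_commute simp flip: power2_norm_eq_inner)
    qed simp
    then show ?thesis
      using fin that by (simp add: inner_diff_left)
  qed
  \<comment> \<open>The remainder is orthogonal to the complement of \<open>S\<close>, so it lies in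
    \<open>S\<close>, where \<open>T\<close> vanishes. The trace of \<open>T\<close> is thus the sum
    of its form over \<open>B\<close>, each term being at most 1.\<close>
  have "v - P *v v \<in> S" for v
  proof -
    have "orthogonal (v - P *v v) w" if "w \<in> span B" for w
      by (rule orthogonal_to_span [OF that]) (simp add: orth_B orthogonal_def)
    then have "v - P *v v \<in> S\<^sup>\<bottom>\<^sup>\<bottom>"
      by (simp add: orthogonal_comp_def span [unfolded orthogonal_comp_def] orthogonal_commute)
    then show ?thesis
      using orthogonal_comp_self [OF S] by simp
  qed
  then have "T *v ((mat 1 - P) *v v) = 0" for v
    using ker by (simp add: matrix_vector_mult_diff_rdistrib)
  then have "T ** (mat 1 - P) = 0"
    by (simp add: matrix_eq matrix_vector_mul_assoc [symmetric])
  then have "T \<bullet> (mat 1 - P) = 0"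
    using sym by (simp add: mat_inner_eq_inner [symmetric] mat_inner_def symmetric_mat_def
        trace_0 [unfolded mat_0])
  then have "trace T = T \<bullet> P"
    by (simp add: trace_eq_inner inner_diff_right inner_commute)
  also have "\<dots> = (\<Sum>b\<in>B. b \<bullet> (T *v b))"
    by (simp add: P_def inner_sum_right inner_outer)
  also have "\<dots> \<le> (\<Sum>b\<in>B. 1)"
  proof (rule sum_mono)
    fix b assume "b \<in> B"
    have "0 \<le> b \<bullet> ((mat 1 - T) *v b)"
      using le by (simp add: loewner_le_def psd_def)
    then show "b \<bullet> (T *v b) \<le> 1"
      using B(2) [OF \<open>b \<in> B\<close>]
      by (simp add: matrix_vector_mult_diff_rdistrib inner_diff_right flip: power2_norm_eq_inner)
  qed
  also have "\<dots> = real (dim (S\<^sup>\<bottom>))"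
    by (simp add: card)
  also have "\<dots> = real CARD('n) - real (dim S)"
  proof -
    have "dim (S\<^sup>\<bottom>) + dim S = CARD('n)"
      using dim_subspace_orthogonal_to_vectors [OF S subspace_UNIV]
      by (simp add: orthogonal_comp_def)
    then show ?thesis
      by linarith
  qed
  finally show ?thesis .
qed

lemma trace_le_of_inner_zero:
  fixes T X :: "real^'n^'n"
  assumes "psd T" and "loewner_le T (mat 1)" and "psd X" and "T \<bullet> X = 0"
  shows "trace T \<le> real CARD('n) - real (rank X)"
proof -
  have "trace T \<le> real CARD('n) - real (dim (range ((*v) X)))"
    using assms psd_inner_zero [of T X]
    by (intro trace_le_of_kernel linear_subspace_image) (auto simp: psd_def)
  then show ?thesis
    by (simp add: rank_dim_range)
qed

section \<open>The span of the \<open>A i\<close> and weak duality\<close>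

lemma lin_comb_inner: "lin_comb m A t \<bullet> X = (\<Sum>i=1..m. t i * (A i \<bullet> X))"
  by (simp add: lin_comb_def inner_sum_left)

lemma subspace_range_lin_comb: "subspace (range (lin_comb m A))"
proof (rule subspaceI)
  show "0 \<in> range (lin_comb m A)"
    by (rule range_eqI [of _ _ "\<lambda>_. 0"]) (simp add: lin_comb_def)
next
  fix x y assume "x \<in> range (lin_comb m A)" "y \<in> range (lin_comb m A)"
  then obtain s t where "x = lin_comb m A s" "y = lin_comb m A t"
    by auto
  then have "x + y = lin_comb m A (\<lambda>i. s i + t i)"
    by (simp add: lin_comb_def scaleR_add_left sum.distrib)
  then show "x + y \<in> range (lin_comb m A)"
    by simp
next
  fix c x assume "x \<in> range (lin_comb m A)"
  then obtain s where "x = lin_comb m A s"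
    by auto
  then have "c *\<^sub>R x = lin_comb m A (\<lambda>i. c * s i)"
    by (simp add: lin_comb_def scaleR_sum_right)
  then show "c *\<^sub>R x \<in> range (lin_comb m A)"
    by simp
qed

text \<open>In finite dimension a subspace equals its double orthogonal complement. This recovers
  the coefficients \<open>t\<close> from a separating normal.\<close>

lemma lin_comb_if_orthogonal:
  assumes "\<And>Z. \<forall>i\<in>{1..m}. A i \<bullet> Z = 0 \<Longrightarrow> W \<bullet> Z = 0"
  shows "\<exists>t. W = lin_comb m A t"
proof -
  have "A i = lin_comb m A (\<lambda>j. if j = i then 1 else 0)" if "i \<in> {1..m}" for i
    using that by (simp add: lin_comb_def if_distrib [of "\<lambda>c. c *\<^sub>R _"] cong: if_cong)
  then have "A i \<in> range (lin_comb m A)" if "i \<in> {1..m}" for i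
    using that by blast
  then have "\<forall>i\<in>{1..m}. A i \<bullet> Z = 0" if "Z \<in> (range (lin_comb m A))\<^sup>\<bottom>" for Z
    using that unfolding orthogonal_comp_def orthogonal_def by blast
  then have "W \<in> (range (lin_comb m A))\<^sup>\<bottom>\<^sup>\<bottom>"
    using assms by (auto simp: orthogonal_comp_def [of "_\<^sup>\<bottom>"] orthogonal_def inner_commute)
  then show ?thesis
    by (auto simp: orthogonal_comp_self [OF subspace_range_lin_comb])
qed

lemma mem_primal_values_iff:
  "v \<in> primal_values m A \<longleftrightarrow>
    (\<exists>t. v = trace (lin_comb m A t) \<and> psd (lin_comb m A t) \<and> loewner_le (lin_comb m A t) (mat 1))"
  by (auto simp: primal_values_def trace_lin_comb)

text \<open>Moving the right-hand side \<open>trace (A i)\<close> into the inner product gives the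
  constraint the shape used in \<open>dual_cone\<close>.\<close>

lemma mem_dual_values_iff:
  "v \<in> dual_values m A \<longleftrightarrow>
    (\<exists>X Y. v = trace X \<and> (\<forall>i\<in>{1..m}. A i \<bullet> (mat 1 - X + Y) = 0) \<and> psd X \<and> psd Y)"
proof -
  have "A i \<bullet> (mat 1 - X + Y) = 0 \<longleftrightarrow> mat_inner (A i) X - mat_inner (A i) Y = trace (A i)" for i X Y
    by (auto simp: mat_inner_eq_inner trace_eq_inner inner_diff_right inner_add_right
        inner_commute [of "mat 1"])
  then show ?thesis
    by (auto simp: dual_values_def mat_inner_eq_inner trace_eq_inner)
qed

text \<open>For \<open>T = lin_comb m A t\<close> the dual constraints give
  \<open>trace T = T \<bullet> X - T \<bullet> Y\<close>. This is at most
  \<open>T \<bullet> X\<close>, hence at most \<open>trace X\<close>.\<close>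

lemma weak_duality:
  assumes "p \<in> primal_values m A" and "d \<in> dual_values m A"
  shows "p \<le> d"
proof -
  obtain t where t: "p = trace (lin_comb m A t)" "psd (lin_comb m A t)"
    "psd (mat 1 - lin_comb m A t)"
    using assms(1) by (auto simp: mem_primal_values_iff loewner_le_def)
  obtain X Y where XY: "d = trace X" "\<forall>i\<in>{1..m}. A i \<bullet> (mat 1 - X + Y) = 0" "psd X" "psd Y"
    using assms(2) by (auto simp: mem_dual_values_iff)
  have "lin_comb m A t \<bullet> (mat 1 - X + Y) = 0"
    using XY(2) by (simp add: lin_comb_inner)
  moreover have "0 \<le> lin_comb m A t \<bullet> Y" "0 \<le> (mat 1 - lin_comb m A t) \<bullet> X"
    using t XY psd_inner_nonneg by blast+
  ultimately show ?thesis
    by (simp add: t(1) XY(1) trace_eq_inner inner_diff_right inner_diff_left inner_add_right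
        inner_commute)
qed

section \<open>Separation and strong duality\<close>

lemma nonpos_of_bounded_multiples:
  fixes a b :: real
  assumes "\<And>s. 0 < s \<Longrightarrow> s * a \<le> b"
  shows "a \<le> 0"
proof (rule ccontr)
  assume "\<not> a \<le> 0"
  \<comment> \<open>The chosen factor would give \<open>\<bar>b\<bar> + 1 \<le> b\<close>.\<close>
  then show False
    using assms [of "(\<bar>b\<bar> + 1) / a"] by simp
qed

text \<open>A strict epigraph of the dual value as a function of the right-hand side
  \<open>A i \<bullet> Z\<close>; \<open>Z = mat 1\<close> is the original problem. Strictness keeps
  \<open>(mat 1, dual_opt m A)\<close> outside even when the infimum is attained.\<close>

definition dual_cone :: "nat \<Rightarrow> (nat \<Rightarrow> real^'n^'n) \<Rightarrow> ((real^'n^'n) \<times> real) set" where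
  "dual_cone m A = {(Z, r). \<exists>X Y. psd X \<and> psd Y \<and>
    (\<forall>i\<in>{1..m}. A i \<bullet> (Z - X + Y) = 0) \<and> trace X < r}"

lemma dual_coneI:
  assumes "psd X" "psd Y" "\<And>i. i \<in> {1..m} \<Longrightarrow> A i \<bullet> (Z - X + Y) = 0" "trace X < r"
  shows "(Z, r) \<in> dual_cone m A"
  using assms unfolding dual_cone_def by blast

lemma dual_coneE:
  assumes "(Z, r) \<in> dual_cone m A"
  obtains X Y where "psd X" "psd Y" "trace X < r" "\<forall>i\<in>{1..m}. A i \<bullet> (Z - X + Y) = 0"
  using assms unfolding dual_cone_def by blast

lemma dual_cone_add:
  assumes "(Z, r) \<in> dual_cone m A" and "(Z', r') \<in> dual_cone m A"
  shows "(Z + Z', r + r') \<in> dual_cone m A"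
proof -
  obtain X Y where XY: "psd X" "psd Y" "trace X < r"
    and A: "\<forall>i\<in>{1..m}. A i \<bullet> (Z - X + Y) = 0"
    using assms(1) by (rule dual_coneE)
  obtain X' Y' where XY': "psd X'" "psd Y'" "trace X' < r'"
    and A': "\<forall>i\<in>{1..m}. A i \<bullet> (Z' - X' + Y') = 0"
    using assms(2) by (rule dual_coneE)
  show ?thesis
  proof (rule dual_coneI)
    show "psd (X + X')" "psd (Y + Y')"
      using XY XY' by (simp_all add: psd_add)
    show "trace (X + X') < r + r'"
      using XY XY' by (simp add: trace_add)
    fix i assume "i \<in> {1..m}"
    have "Z + Z' - (X + X') + (Y + Y') = (Z - X + Y) + (Z' - X' + Y')"
      by simp
    then have "A i \<bullet> (Z + Z' - (X + X') + (Y + Y'))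
        = A i \<bullet> (Z - X + Y) + A i \<bullet> (Z' - X' + Y')"
      by (simp only: inner_add_right [of _ "Z - X + Y"])
    also have "\<dots> = 0"
      using A A' \<open>i \<in> {1..m}\<close> by simp
    finally show "A i \<bullet> (Z + Z' - (X + X') + (Y + Y')) = 0" .
  qed
qed

lemma dual_cone_scale:
  assumes "(Z, r) \<in> dual_cone m A" and "0 < s"
  shows "(s *\<^sub>R Z, s * r) \<in> dual_cone m A"
proof -
  obtain X Y where XY: "psd X" "psd Y" "trace X < r"
    and A: "\<forall>i\<in>{1..m}. A i \<bullet> (Z - X + Y) = 0"
    using assms(1) by (rule dual_coneE)
  show ?thesis
  proof (rule dual_coneI)
    show "psd (s *\<^sub>R X)" "psd (s *\<^sub>R Y)" "trace (s *\<^sub>R X) < s * r"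
      using XY \<open>0 < s\<close> by (simp_all add: psd_scaleR trace_eq_inner)
    fix i assume "i \<in> {1..m}"
    have "s *\<^sub>R Z - s *\<^sub>R X + s *\<^sub>R Y = s *\<^sub>R (Z - X + Y)"
      by (simp add: algebra_simps)
    then show "A i \<bullet> (s *\<^sub>R Z - s *\<^sub>R X + s *\<^sub>R Y) = 0"
      using A \<open>i \<in> {1..m}\<close> by simp
  qed
qed

lemma convex_dual_cone: "convex (dual_cone m A)"
proof (rule convexI)
  fix x y and u v :: real
  assume *: "x \<in> dual_cone m A" "y \<in> dual_cone m A" "0 \<le> u" "0 \<le> v" "u + v = 1"
  show "u *\<^sub>R x + v *\<^sub>R y \<in> dual_cone m A"
  \<comment> \<open>Scaling by 0 would leave the cone, where \<open>r\<close> is always positive, so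
    the endpoints are treated apart.\<close>
  proof (cases "u = 0 \<or> v = 0")
    case True
    then show ?thesis
      using * by auto
  next
    case False
    then show ?thesis
      using * by (cases x; cases y) (auto intro!: dual_cone_add dual_cone_scale)
  qed
qed

lemma zero_one_in_dual_cone: "(0, 1) \<in> dual_cone m A"
  by (rule dual_coneI [of 0 0]) (simp_all add: psd_0 trace_eq_inner)

lemma strong_duality:
  fixes A :: "nat \<Rightarrow> real^'n^'n"
  assumes sym: "\<And>i. i \<in> {1..m} \<Longrightarrow> symmetric_mat (A i)"
  shows "\<exists>p \<in> primal_values m A. dual_opt m A \<le> p"
proof -
  have "(mat 1, dual_opt m A) \<notin> dual_cone m A"
  proof
    assume "(mat 1, dual_opt m A) \<in> dual_cone m A"
    then obtain X Y where "psd X" "psd Y" "trace X < dual_opt m A"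
      and "\<forall>i\<in>{1..m}. A i \<bullet> (mat 1 - X + Y) = 0"
      by (rule dual_coneE)
    then have "trace X \<in> dual_values m A"
      unfolding mem_dual_values_iff by blast
    then have "dual_opt m A \<le> trace X"
      unfolding dual_opt_def by (rule cInf_lower [OF _ dual_values_bdd_below])
    then show False
      using \<open>trace X < dual_opt m A\<close> by simp
  qed
  moreover have "dual_cone m A \<noteq> {}"
    using zero_one_in_dual_cone by blast
  ultimately obtain a b where "a \<noteq> 0" and a_le: "\<forall>x\<in>dual_cone m A. a \<bullet> x \<le> b"
    and a_ge: "a \<bullet> (mat 1, dual_opt m A) \<ge> b"
    using separating_hyperplane_sets [of "dual_cone m A" "{(mat 1, dual_opt m A)}"]
      convex_dual_cone [of m A] by auto
  obtain W w where a: "a = (W, w)"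
    by (cases a)
  have cone_le: "s * (W \<bullet> Z + w * r) \<le> b" if "(Z, r) \<in> dual_cone m A" "0 < s" for Z r s
    using bspec [OF a_le dual_cone_scale [OF that]] by (simp add: a algebra_simps)
  have cone: "W \<bullet> Z + w * r \<le> 0" if "(Z, r) \<in> dual_cone m A" for Z r
    using cone_le [OF that] by (rule nonpos_of_bounded_multiples)
  have w_le: "s * w \<le> b" if "0 < s" for s
    using cone_le [OF zero_one_in_dual_cone that] by simp
  \<comment> \<open>The cone contains arbitrarily small multiples of \<open>(0, 1)\<close>. If
    \<open>b < 0\<close>, then \<open>w \<le> b < 0\<close> makes the factor
    \<open>b / (2 * w)\<close> positive, and it yields \<open>b / 2 \<le> b\<close>.\<close>
  have "b \<ge> 0"
  proof (rule ccontr)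
    assume "\<not> b \<ge> 0"
    moreover have "w \<le> b"
      using w_le [of 1] by simp
    ultimately show False
      using w_le [of "b / (2 * w)"] by (simp add: divide_neg_neg)
  qed
  then have opt: "W \<bullet> mat 1 + w * dual_opt m A \<ge> 0"
    using a_ge by (simp add: a)
  have "w \<le> 0"
    using cone [OF zero_one_in_dual_cone] by simp
  \<comment> \<open>With \<open>X = Y = 0\<close> and \<open>r = 1\<close>, every real multiple of
    \<open>Z\<close> lies in the cone, so \<open>W \<bullet> Z\<close> can have neither
    sign.\<close>
  have "W \<bullet> Z = 0" if "\<forall>i\<in>{1..m}. A i \<bullet> Z = 0" for Z
  proof -
    have bound: "c * (W \<bullet> Z) \<le> - w" for c
      using cone [OF dual_coneI [of 0 0 m A "c *\<^sub>R Z" 1]] that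
      by (simp add: psd_0 trace_eq_inner)
    have "W \<bullet> Z \<le> 0"
      using bound by (rule nonpos_of_bounded_multiples)
    moreover have "- (W \<bullet> Z) \<le> 0"
      by (rule nonpos_of_bounded_multiples [of _ "- w"]) (use bound [of "- _"] in simp)
    ultimately show ?thesis
      by simp
  qed
  then obtain t where W: "W = lin_comb m A t"
    using lin_comb_if_orthogonal by blast
  have W_sym: "symmetric_mat W"
    using sym unfolding W by (rule symmetric_lin_comb)
  have "psd W"
    unfolding psd_def
  proof (intro conjI allI W_sym)
    fix v
    \<comment> \<open>Test point with \<open>X = 0\<close> and \<open>Z = - Y\<close>, a negative
      multiple of \<open>outer v\<close>.\<close>
    have "s * - (v \<bullet> (W *v v)) \<le> - w" if "0 < s" for s
      using cone [OF dual_coneI [of 0 "s *\<^sub>R outer v" m A "- s *\<^sub>R outer v" 1]] that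
      by (simp add: psd_0 psd_scaleR psd_outer trace_eq_inner inner_outer)
    from nonpos_of_bounded_multiples [OF this] show "0 \<le> v \<bullet> (W *v v)"
      by simp
  qed
  have upper: "v \<bullet> (W *v v) \<le> - w * (v \<bullet> v)" for v
  proof -
    \<comment> \<open>Test point with \<open>Y = 0\<close> and \<open>Z = X\<close>;
      \<open>r\<close> exceeds \<open>trace X = s * (v \<bullet> v)\<close> by 1.\<close>
    have "s * (v \<bullet> (W *v v) + w * (v \<bullet> v)) \<le> - w" if "0 < s" for s
      using cone [OF dual_coneI [of "s *\<^sub>R outer v" 0 m A "s *\<^sub>R outer v" "s * (v \<bullet> v) + 1"]] that
      by (simp add: psd_0 psd_scaleR psd_outer trace_eq_inner inner_outer algebra_simps)
    from nonpos_of_bounded_multiples [OF this] show ?thesis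
      by simp
  qed
  \<comment> \<open>For \<open>w = 0\<close> the bounds on the form of \<open>W\<close> from both
    sides are 0, so the whole normal \<open>a\<close> would vanish.\<close>
  have "w \<noteq> 0"
  proof
    assume "w = 0"
    have "v \<bullet> (W *v v) = 0" for v
      using upper [of v] \<open>psd W\<close> \<open>w = 0\<close> by (simp add: psd_def order_antisym)
    then have "W = 0"
      using psd_quadratic_zero [OF \<open>psd W\<close>] by (simp add: matrix_eq)
    then show False
      using \<open>a \<noteq> 0\<close> \<open>w = 0\<close> by (simp add: a zero_prod_def)
  qed
  then have "w < 0"
    using \<open>w \<le> 0\<close> by simp
  \<comment> \<open>Dividing by \<open>- w > 0\<close> turns \<open>upper\<close> into
    \<open>T\<close> being below the identity and \<open>opt\<close> into
    \<open>dual_opt m A \<le> trace T\<close>.\<close>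
  define T where "T = (- 1 / w) *\<^sub>R W"
  have T: "T = lin_comb m A (\<lambda>i. (- 1 / w) * t i)"
    by (simp only: T_def W lin_comb_def scaleR_sum_right scaleR_scaleR)
  have "psd T"
    using \<open>psd W\<close> \<open>w < 0\<close> by (simp only: T_def) (intro psd_scaleR, auto)
  moreover have "loewner_le T (mat 1)"
    unfolding loewner_le_def psd_def
  proof (intro conjI allI)
    show "symmetric_mat (mat 1 - T)"
      using \<open>psd T\<close> by (auto simp: psd_def symmetric_mat_def vec_eq_iff transpose_def mat_def)
    fix v
    show "0 \<le> v \<bullet> ((mat 1 - T) *v v)"
      using upper [of v] \<open>w < 0\<close>
      by (simp add: T_def matrix_vector_mult_add_rdistrib inner_add_right
          scaleR_matrix_vector_assoc [symmetric] field_simps)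
  qed
  ultimately have "trace T \<in> primal_values m A"
    using T by (auto simp: mem_primal_values_iff)
  moreover have "dual_opt m A \<le> trace T"
    using opt \<open>w < 0\<close> by (simp add: T_def trace_eq_inner inner_commute field_simps)
  ultimately show ?thesis
    by blast
qed

lemma primal_opt_eq_dual_opt:
  assumes "\<And>i. i \<in> {1..m} \<Longrightarrow> symmetric_mat (A i)"
  shows "primal_opt m A = dual_opt m A"
proof (rule antisym)
  show "primal_opt m A \<le> dual_opt m A"
    unfolding primal_opt_def dual_opt_def
    by (intro cSup_least cInf_greatest primal_values_nonempty dual_values_nonempty assms weak_duality)
  show "dual_opt m A \<le> primal_opt m A"
    unfolding primal_opt_def
    using strong_duality [OF assms] cSup_upper [OF _ primal_values_bdd_above] order_trans by meson
qed

section \<open>The rank bound\<close>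

theorem theorem3p8:
  fixes A :: "nat \<Rightarrow> real^'n^'n" and m :: nat and \<eta> :: real
  assumes "m \<ge> 1"
    and "\<And>i. i \<in> {1..m} \<Longrightarrow> symmetric_mat (A i)"
    and "\<eta> = primal_opt m A \<or> \<eta> = dual_opt m A"
  shows "primal_opt m A = dual_opt m A \<and>
    (int (max_psd_rank m A) \<le> int CARD('n) - 2 \<longrightarrow>
      (\<forall>X :: real^'n^'n. X \<noteq> 0 \<and> symmetric_mat X \<and> psd X \<and> (\<forall>i\<in>{1..m}. mat_inner (A i) X = 0)
         \<longrightarrow> int (rank X) \<le> int CARD('n) - \<lceil>\<eta>\<rceil>))"
proof (intro conjI impI allI)
  show eq: "primal_opt m A = dual_opt m A"
    using assms(2) by (rule primal_opt_eq_dual_opt)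
  fix X :: "real^'n^'n"
  assume X: "X \<noteq> 0 \<and> symmetric_mat X \<and> psd X \<and> (\<forall>i\<in>{1..m}. mat_inner (A i) X = 0)"
  then have "lin_comb m A t \<bullet> X = 0" for t
    by (simp add: lin_comb_inner mat_inner_eq_inner)
  then have "p \<le> real CARD('n) - real (rank X)" if "p \<in> primal_values m A" for p
    using that X trace_le_of_inner_zero by (auto simp: mem_primal_values_iff)
  then have "primal_opt m A \<le> real CARD('n) - real (rank X)"
    unfolding primal_opt_def by (rule cSup_least [OF primal_values_nonempty])
  \<comment> \<open>The bound is an integer, so it passes to the ceiling of
    \<open>\<eta>\<close>.\<close>
  then have "\<eta> \<le> of_int (int CARD('n) - int (rank X))"
    using assms(3) eq by auto
  then have "\<lceil>\<eta>\<rceil> \<le> int CARD('n) - int (rank X)"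
    by (simp only: ceiling_le)
  then show "int (rank X) \<le> int CARD('n) - \<lceil>\<eta>\<rceil>"
    by simp
qed

end
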